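(* Let $d=rk$ where $r\ge2$ and $k\ge2$ are integers. Then the following two $(d,\Pi)$ are exceptional for branched covers $\mathbb S^2\to\mathbb S^2$: (1) $\Pi=[(2k-1,\ \underbrace{1,\dots,1}_{(r-2)k+1}),\ (\underbrace{r,\dots,r}_{k}),\ (\underbrace{r,\dots,r}_{k})]$; (2) $\Pi=[(j_1,\ j_2,\ \underbrace{1,\dots,1}_{(r-2)k}),\ (\underbrace{r,\dots,r}_{k}),\ (\underbrace{r,\dots,r}_{k})]$, where $j_1,j_2$ are positive integers with $j_1\ne j_2$ and $j_1+j_2=2k$.
   Context: A branched cover $f:\mathbb S^2\to\mathbb S^2$ of degree $d$ is a non-constant holomorphic map of the Riemann sphere of degree $d$. Near each point $q$ of the source it has, in suitable local holomorphic coordinates, the form $z\mapsto z^{e_q}$, where $e_q\in\mathbb N$ is the local ramification index. The branching points are the images of the points with $e_q\ge2$. A candidate branch datum $(d,\Pi)$ consists of $d\in\mathbb N$ and a list of $n$ tuples of positive integers $\Pi=[(\Pi_1^1,\dots,\Pi_1^{\ell_1}),\dots,(\Pi_n^1,\dots,\Pi_n^{\ell_n})]$ such that for each $i$ at least one $\Pi_i^j\ge2$, $\sum_j\Pi_i^j=d$ for each $i$, and $2=2d-\sum_{i=1}^n\sum_{j=1}^{\ell_i}(\Pi_i^j-1)$ (Riemann–Hurwitz). It is realized by a branched cover $f:\mathbb S^2\to\mathbb S^2$ of degree $d$ if $f$ has exactly $n$ distinct branching points $p_1,\dots,p_n$ and, for each $i$, the preimage $f^{-1}(p_i)$ consists of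 $\ell_i$ points with local ramification indices $\Pi_i^1,\dots,\Pi_i^{\ell_i}$ (up to order). The datum is exceptional if it is a candidate branch datum that is not realized by any branched cover $\mathbb S^2\to\mathbb S^2$. An underbrace with a number indicates how many entries are in the underbraced list. *)

theory Defs
  imports "HOL-Analysis.Analysis" "HOL-Library.Multiset"
begin

section \<open>The Riemann sphere\<close>

text \<open>The underlying set is \<^typ>\<open>complex option\<close>, with \<^const>\<open>None\<close> as the point at infinity.\<close>

type_synonym rsphere = "complex option"

abbreviation sphere_top :: "rsphere topology" where
  "sphere_top \<equiv> Alexandroff_compactification euclidean"

text \<open>The complex structure is given by two charts: \<^term>\<open>the\<close> on \<^term>\<open>range Some\<close>, with inverse
  \<^const>\<open>Some\<close>, and the map $z \mapsto 1/z$ on the complement of the origin, with the following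
  inverse.\<close>

definition param_inf :: "complex \<Rightarrow> rsphere" where
  "param_inf w = (if w = 0 then None else Some (inverse w))"

definition chart_inf :: "rsphere \<Rightarrow> complex" where
  "chart_inf p = (case p of None \<Rightarrow> 0 | Some z \<Rightarrow> inverse z)"

definition sphere_charts :: "(rsphere set \<times> (rsphere \<Rightarrow> complex)) set" where
  "sphere_charts = {(range Some, the), (- {Some 0}, chart_inf)}"

section \<open>Holomorphic functions and maps\<close>

definition holo_fun_on :: "(rsphere \<Rightarrow> complex) \<Rightarrow> rsphere set \<Rightarrow> bool" where
  "holo_fun_on \<phi> U \<longleftrightarrow> openin sphere_top U \<and>
     (\<phi> \<circ> Some) holomorphic_on (Some -` U) \<and>
     (\<phi> \<circ> param_inf) holomorphic_on (param_inf -` U)"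

definition holo_map :: "(rsphere \<Rightarrow> rsphere) \<Rightarrow> bool" where
  "holo_map f \<longleftrightarrow> continuous_map sphere_top sphere_top f \<and>
     (\<forall>(V, \<psi>) \<in> sphere_charts. holo_fun_on (\<psi> \<circ> f) (f -` V))"

text \<open>A local holomorphic coordinate centred at \<open>q\<close>. An injective holomorphic function is
  automatically biholomorphic onto an open subset of the plane.\<close>

definition local_coord :: "rsphere \<Rightarrow> rsphere set \<Rightarrow> (rsphere \<Rightarrow> complex) \<Rightarrow> bool" where
  "local_coord q U \<phi> \<longleftrightarrow> q \<in> U \<and> holo_fun_on \<phi> U \<and> inj_on \<phi> U \<and> \<phi> q = 0"

section \<open>Ramification and branched covers\<close>

text \<open>Near \<open>q\<close> the map \<open>f\<close> has the form $z \mapsto z^e$ in suitable local coordinates. The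
  coordinates are centred, so this forces \<open>e \<ge> 1\<close>.\<close>

definition local_power_form :: "(rsphere \<Rightarrow> rsphere) \<Rightarrow> rsphere \<Rightarrow> nat \<Rightarrow> bool" where
  "local_power_form f q e \<longleftrightarrow>
     (\<exists>U \<phi> V \<psi>. local_coord q U \<phi> \<and> local_coord (f q) V \<psi> \<and> f ` U \<subseteq> V \<and>
        (\<forall>x\<in>U. \<psi> (f x) = \<phi> x ^ e))"

definition ram_index :: "(rsphere \<Rightarrow> rsphere) \<Rightarrow> rsphere \<Rightarrow> nat" where
  "ram_index f q = (THE e. local_power_form f q e)"

text \<open>The degree is the number of preimages of any point, counted with multiplicity; for
  a non-constant holomorphic map this number is finite and the same for all points.\<close>

definition has_degree :: "(rsphere \<Rightarrow> rsphere) \<Rightarrow> nat \<Rightarrow> bool" where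
  "has_degree f d \<longleftrightarrow> (\<forall>p. finite (f -` {p}) \<and> (\<Sum>q\<in>f -` {p}. ram_index f q) = d)"

definition branched_cover :: "(rsphere \<Rightarrow> rsphere) \<Rightarrow> nat \<Rightarrow> bool" where
  "branched_cover f d \<longleftrightarrow> holo_map f \<and> \<not> f constant_on UNIV \<and> has_degree f d"

definition branching_points :: "(rsphere \<Rightarrow> rsphere) \<Rightarrow> rsphere set" where
  "branching_points f = f ` {q. ram_index f q \<ge> 2}"

section \<open>Branch data\<close>

definition candidate_branch_datum :: "nat \<Rightarrow> nat list list \<Rightarrow> bool" where
  "candidate_branch_datum d D \<longleftrightarrow>
     (\<forall>\<pi>\<in>set D. (\<forall>m\<in>set \<pi>. m \<ge> 1) \<and> (\<exists>m\<in>set \<pi>. m \<ge> 2) \<and> sum_list \<pi> = d) \<and>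
     2 = 2 * int d - (\<Sum>\<pi>\<leftarrow>D. (\<Sum>m\<leftarrow>\<pi>. (int m - 1)))"

text \<open>The list \<open>ps\<close> enumerates the branching points without repetition; the ramification indices
  over \<open>ps ! i\<close> are compared with \<open>D ! i\<close> as multisets, that is, up to order.\<close>

definition realizes :: "(rsphere \<Rightarrow> rsphere) \<Rightarrow> nat \<Rightarrow> nat list list \<Rightarrow> bool" where
  "realizes f d D \<longleftrightarrow> branched_cover f d \<and>
     (\<exists>ps. length ps = length D \<and> distinct ps \<and> set ps = branching_points f \<and>
        (\<forall>i<length D. image_mset (ram_index f) (mset_set (f -` {ps ! i})) = mset (D ! i)))"

definition exceptional :: "nat \<Rightarrow> nat list list \<Rightarrow> bool" where
  "exceptional d D \<longleftrightarrow> candidate_branch_datum d D \<and> \<not> (\<exists>f. realizes f d D)"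

end

theory Submission
  imports Defs "HOL-Complex_Analysis.Complex_Analysis"
begin

text \<open>
  Suppose that \<open>f\<close> has two fibres, over \<open>p0\<close> and \<open>p1\<close>, each made of \<open>k\<close> points of ramification
  index \<open>r\<close>. Choose target coordinates in which \<open>p0\<close> is the origin and \<open>p1\<close> is infinity. Every zero and
  every pole of \<open>f\<close> then has order \<open>r\<close>, so \<open>f\<close> is an \<open>r\<close>-th power \<open>g ^ r\<close> with \<open>g\<close> of degree \<open>k\<close>.
  A value \<open>c\<close> of \<open>f\<close> other than zero and infinity has \<open>r\<close> distinct \<open>r\<close>-th roots, so each point
  over \<open>c\<close> is a preimage under \<open>g\<close> of exactly one of them, with the same ramification index. No index
  over \<open>c\<close> can therefore exceed \<open>deg g = k\<close> (lemma \<open>ram_index_le_of_homogeneous_fibres\<close>). The first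
  datum asks for the index \<open>2 * k - 1 > k\<close>, the second one for \<open>j1\<close> and \<open>j2\<close>, the larger of which
  exceeds their average \<open>k\<close>. Hence neither is realized.

  To make this precise with little machinery, put the point \<open>q\<close> whose index \<open>e\<close> is to be bounded at
  infinity in the source. Liouville's theorem gives \<open>f = c * (P / Q) ^ r\<close> with monic polynomials \<open>P\<close>
  and \<open>Q\<close> of degree \<open>k\<close>. The index \<open>e\<close> is the order to which \<open>f - c\<close> vanishes at infinity, that is
  the drop of degree from \<open>Q ^ r\<close> to \<open>P ^ r - Q ^ r\<close>. The latter is \<open>P - Q\<close> times a polynomial
  of degree exactly \<open>(r - 1) * k\<close>, so the drop is at most \<open>k\<close> (lemma
  \<open>contact_order_at_infinity_le\<close>).

  The remaining work links this to the sphere. All points of the sphere are treated alike by using,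
  for each point \<open>x\<close>, an affine coordinate on the complement of \<open>x\<close>. In such coordinates the
  ramification index is an order of vanishing (lemma \<open>local_power_form_order\<close>). As
  \<^const>\<open>ram_index\<close> is a definite description, this also requires that a local power form exists
  at every point.
\<close>

section \<open>Affine coordinates on the sphere minus a point\<close>

text \<open>A bijection from the plane to the complement of \<open>x\<close> that sends infinity to \<open>x\<close>. It is
  \<^const>\<open>Some\<close> if \<open>x\<close> is infinity and \<^const>\<open>param_inf\<close> if \<open>x\<close> is the origin, so the inverses of
  both defining charts are instances.\<close>

definition affine_param :: "rsphere \<Rightarrow> complex \<Rightarrow> rsphere" where
  "affine_param x w = (case x of None \<Rightarrow> Some w
     | Some a \<Rightarrow> if w = 0 then None else Some (a + inverse w))"

text \<open>The inverse of \<^const>\<open>affine_param\<close>. Its value at \<open>x\<close> itself is meaningless.\<close>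

definition affine_coord :: "rsphere \<Rightarrow> rsphere \<Rightarrow> complex" where
  "affine_coord x p = (case x of None \<Rightarrow> the p
     | Some a \<Rightarrow> (case p of None \<Rightarrow> 0 | Some z \<Rightarrow> inverse (z - a)))"

lemma affine_param_None: "affine_param None = Some"
  by (simp add: fun_eq_iff affine_param_def)

lemma affine_param_Some_0: "affine_param (Some 0) = param_inf"
  by (simp add: fun_eq_iff affine_param_def param_inf_def)

lemma affine_coord_None: "affine_coord None = the"
  by (simp add: fun_eq_iff affine_coord_def)

lemma affine_coord_param [simp]: "affine_coord x (affine_param x w) = w"
  by (auto simp: affine_coord_def affine_param_def split: option.splits)

lemma affine_param_coord [simp]: "p \<noteq> x \<Longrightarrow> affine_param x (affine_coord x p) = p"
  by (auto simp: affine_coord_def affine_param_def split: option.splits)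

lemma affine_param_neq [simp]: "affine_param x w \<noteq> x" "x \<noteq> affine_param x w"
  by (auto simp: affine_param_def split: option.splits)

lemma inj_affine_param: "inj (affine_param x)"
  by (metis affine_coord_param injI)

lemma exists_other_point: "\<exists>x :: rsphere. x \<noteq> q"
  by (cases q) auto

lemma affine_coord_eq_iff:
  assumes "p \<noteq> x" "q \<noteq> x"
  shows "affine_coord x p = affine_coord x q \<longleftrightarrow> p = q"
  using assms by (metis affine_param_coord)

text \<open>The transition between the coordinates with poles at \<open>x\<close> and at \<open>y\<close> is a Moebius map that
  exchanges infinity with a finite point, hence of the form \<open>u = a + K / (v - b)\<close>. On the source
  this compares a neighbourhood of infinity with a disc, on the target it exchanges zeros and
  poles.\<close>

lemma affine_coord_mult:
  assumes "x \<noteq> y"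
  obtains K where "K \<noteq> 0"
    and "\<And>p. p \<noteq> x \<Longrightarrow> p \<noteq> y \<Longrightarrow>
      (affine_coord x p - affine_coord x y) * (affine_coord y p - affine_coord y x) = K"
proof (cases x)
  case None
  then obtain b where b: "y = Some b" using assms by (cases y) auto
  show ?thesis
  proof
    show "(1::complex) \<noteq> 0" by simp
  qed (use None b in \<open>auto simp: affine_coord_def split: option.splits\<close>)
next
  case (Some a)
  show ?thesis
  proof (cases y)
    case None
    show ?thesis
    proof
      show "(1::complex) \<noteq> 0" by simp
    qed (use None Some in \<open>auto simp: affine_coord_def split: option.splits\<close>)
  next
    case y: (Some b)
    then have ab: "a - b \<noteq> 0" "b - a \<noteq> 0" using Some assms by auto
    show ?thesis
    proof
      show "inverse (a - b) * inverse (b - a) \<noteq> 0" using ab by simp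
      fix p assume p: "p \<noteq> x" "p \<noteq> y"
      show "(affine_coord x p - affine_coord x y) * (affine_coord y p - affine_coord y x)
              = inverse (a - b) * inverse (b - a)"
      proof (cases p)
        case None
        then show ?thesis using Some y by (simp add: affine_coord_def)
      next
        case z: (Some z)
        have rearrange: "(b - z) * (s * t) * ((a - z) * (u * v)) = ((z - a) * s) * ((z - b) * u) * (v * t)"
          for s t u v :: complex by algebra
        have "z - a \<noteq> 0" "z - b \<noteq> 0" using p z Some y by auto
        then have "inverse (z - a) - inverse (b - a) = (b - z) * (inverse (z - a) * inverse (b - a))"
          and "inverse (z - b) - inverse (a - b) = (a - z) * (inverse (z - b) * inverse (a - b))"
          using ab by (simp_all add: field_simps)
        then have "(inverse (z - a) - inverse (b - a)) * (inverse (z - b) - inverse (a - b)) =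
            ((z - a) * inverse (z - a)) * ((z - b) * inverse (z - b)) * (inverse (a - b) * inverse (b - a))"
          by (simp only: rearrange)
        then show ?thesis using \<open>z - a \<noteq> 0\<close> \<open>z - b \<noteq> 0\<close> Some y z
          by (simp add: affine_coord_def)
      qed
    qed
  qed
qed

section \<open>Open sets and holomorphy in affine coordinates\<close>

text \<open>A set is open in the one-point compactification iff it is open in both charts. For a set that
  contains infinity, a disc around the origin of the second chart is the exterior of a disc in the
  first, and this is what makes the complement compact.\<close>

lemma openin_sphere_top_iff:
  "openin sphere_top U \<longleftrightarrow> open (Some -` U) \<and> open (param_inf -` U)"
proof
  assume "openin sphere_top U"
  then consider W where "open W" "U = Some ` W"
    | C where "compact C" "U = insert None (Some ` (UNIV - C))"
    by (auto simp: openin_Alexandroff_compactification)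
  then show "open (Some -` U) \<and> open (param_inf -` U)"
  proof cases
    case 1
    have "param_inf -` U = inverse -` W \<inter> - {0}"
      by (auto simp: 1 param_inf_def split: if_splits)
    moreover have "open (inverse -` W \<inter> - {0::complex})"
      by (intro continuous_open_preimage[of "- {0}", unfolded Int_commute[of "- {0}"]]
          continuous_intros 1) auto
    ultimately show ?thesis using 1 by (simp add: inj_vimage_image_eq)
  next
    case 2
    obtain R where R: "R > 0" "C \<subseteq> cball 0 R"
      using compact_imp_bounded[OF 2(1)] by (metis bounded_subset_ballD ball_subset_cball subset_trans)
    have eq: "param_inf -` U = ball 0 (1 / R) \<union> (inverse -` (- C) \<inter> - {0})"
    proof -
      have "inverse w \<notin> C" if "cmod w < 1 / R" "w \<noteq> 0" for w
      proof
        assume "inverse w \<in> C"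
        then have "inverse (cmod w) \<le> R" using R(2) by (auto simp: norm_inverse)
        then show False using that R(1) by (simp add: field_simps)
      qed
      then show ?thesis using R(1) by (auto simp: 2 param_inf_def split: if_splits)
    qed
    have "open (inverse -` (- C) \<inter> - {0::complex})"
      by (intro continuous_open_preimage[of "- {0}", unfolded Int_commute[of "- {0}"]]
          continuous_intros) (use 2(1) in \<open>auto simp: compact_imp_closed\<close>)
    moreover have "Some -` U = - C" by (auto simp: 2)
    ultimately show ?thesis using 2(1) eq by (auto simp: compact_imp_closed open_Compl)
  qed
next
  assume U: "open (Some -` U) \<and> open (param_inf -` U)"
  show "openin sphere_top U"
  proof (cases "None \<in> U")
    case False
    then have "U = Some ` (Some -` U)" by (auto simp: image_iff) (metis not_None_eq)
    then show ?thesis using U unfolding openin_Alexandroff_compactification by auto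
  next
    case True
    then have "0 \<in> param_inf -` U" by (simp add: param_inf_def)
    then obtain e where e: "e > 0" "ball 0 e \<subseteq> param_inf -` U"
      using U by (meson open_contains_ball)
    have "- (Some -` U) \<subseteq> cball 0 (1 / e)"
    proof
      fix z assume z: "z \<in> - (Some -` U)"
      show "z \<in> cball 0 (1 / e)"
      proof (rule ccontr)
        assume "z \<notin> cball 0 (1 / e)"
        then have lt: "1 / e < cmod z" by simp
        then have "z \<noteq> 0" using e(1) by (auto simp: divide_less_0_iff)
        then have "inverse z \<in> ball 0 e"
          using lt e(1) by (simp add: norm_inverse norm_divide field_simps)
        then have "param_inf (inverse z) \<in> U" using e(2) by auto
        then show False using z \<open>z \<noteq> 0\<close> by (simp add: param_inf_def)
      qed
    qed
    then have "compact (- (Some -` U))"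
      using U by (meson bounded_cball bounded_subset closed_Compl compact_eq_bounded_closed)
    moreover have "U = insert None (Some ` (UNIV - - (Some -` U)))"
      using True by (auto simp: image_iff)
    ultimately show ?thesis
      unfolding openin_Alexandroff_compactification using compact_imp_closed by fastforce
  qed
qed

lemma open_Some_vimage: "openin sphere_top U \<Longrightarrow> open (Some -` U)"
  and open_param_inf_vimage: "openin sphere_top U \<Longrightarrow> open (param_inf -` U)"
  by (simp_all add: openin_sphere_top_iff)

text \<open>Away from zero the coordinate around a finite point factors through the first chart by
  \<open>w \<mapsto> a + 1 / w\<close>, and near zero it factors through the second chart by
  \<open>w \<mapsto> w / (1 + a * w)\<close>. Openness and holomorphy are checked on these two pieces.\<close>

lemma affine_param_vimage_eq:
  "affine_param (Some a) -` U =
     {w \<in> - {0}. a + inverse w \<in> Some -` U} \<union>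
     {w \<in> {w. 1 + a * w \<noteq> 0}. w / (1 + a * w) \<in> param_inf -` U}"
  (is "_ = ?A \<union> ?B")
proof -
  have 1: "affine_param (Some a) w = param_inf (w / (1 + a * w))" if "1 + a * w \<noteq> 0" for w
    using that by (auto simp: affine_param_def param_inf_def field_simps)
  have 2: "affine_param (Some a) w = Some (a + inverse w)" if "w \<noteq> 0" for w
    using that by (simp add: affine_param_def)
  have "w \<in> affine_param (Some a) -` U \<longleftrightarrow> w \<in> ?A \<union> ?B" for w
  proof (cases "w = 0")
    case True
    then show ?thesis by (simp add: 1)
  next
    case False
    then show ?thesis using 1[of w] 2[of w] by auto
  qed
  then show ?thesis by blast
qed

lemma open_shifted_inverse_vimage:
  assumes "open (V :: complex set)"
  shows "open {w \<in> - {0}. a + inverse w \<in> V}"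
proof -
  have "open (- {0} \<inter> (\<lambda>w. a + inverse w) -` V)"
    by (intro continuous_open_preimage continuous_intros assms) auto
  then show ?thesis by (simp add: vimage_def Int_def)
qed

lemma open_moebius_vimage:
  assumes "open (V :: complex set)"
  shows "open {w \<in> {w. 1 + a * w \<noteq> 0}. w / (1 + a * w) \<in> V}"
proof -
  have "open {w. 1 + a * w \<noteq> 0}"
    by (intro open_Collect_neq continuous_intros)
  then have "open ({w. 1 + a * w \<noteq> 0} \<inter> (\<lambda>w. w / (1 + a * w)) -` V)"
    by (intro continuous_open_preimage continuous_intros assms) auto
  then show ?thesis by (simp add: vimage_def Int_def)
qed

lemma open_affine_param_vimage:
  assumes "openin sphere_top U"
  shows "open (affine_param x -` U)"
proof (cases x)
  case None
  then show ?thesis using assms by (simp add: affine_param_None open_Some_vimage)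
next
  case (Some a)
  show ?thesis unfolding Some affine_param_vimage_eq
    by (intro open_Un open_shifted_inverse_vimage open_moebius_vimage
        open_Some_vimage open_param_inf_vimage assms)
qed

text \<open>Holomorphy, defined by the two charts only, can be tested in every affine coordinate on the
  source.\<close>

lemma holo_fun_on_affine_param:
  assumes "holo_fun_on \<phi> U"
  shows "(\<lambda>w. \<phi> (affine_param x w)) holomorphic_on (affine_param x -` U)"
proof (cases x)
  case None
  then show ?thesis using assms by (simp add: affine_param_None holo_fun_on_def o_def)
next
  case (Some a)
  have U: "openin sphere_top U" "(\<phi> \<circ> Some) holomorphic_on Some -` U"
    "(\<phi> \<circ> param_inf) holomorphic_on param_inf -` U"
    using assms by (auto simp: holo_fun_on_def)
  have 1: "(\<lambda>w. \<phi> (affine_param x w)) holomorphic_on {w \<in> - {0}. a + inverse w \<in> Some -` U}"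
  proof (rule holomorphic_transform)
    show "((\<phi> \<circ> Some) \<circ> (\<lambda>w. a + inverse w)) holomorphic_on {w \<in> - {0}. a + inverse w \<in> Some -` U}"
      by (rule holomorphic_on_compose_gen[OF _ U(2)]) (auto intro!: holomorphic_intros)
  qed (auto simp: affine_param_def Some)
  have 2: "(\<lambda>w. \<phi> (affine_param x w)) holomorphic_on
      {w \<in> {w. 1 + a * w \<noteq> 0}. w / (1 + a * w) \<in> param_inf -` U}"
  proof (rule holomorphic_transform)
    show "((\<phi> \<circ> param_inf) \<circ> (\<lambda>w. w / (1 + a * w))) holomorphic_on
        {w \<in> {w. 1 + a * w \<noteq> 0}. w / (1 + a * w) \<in> param_inf -` U}"
      by (rule holomorphic_on_compose_gen[OF _ U(3)]) (auto intro!: holomorphic_intros)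
    fix w assume "w \<in> {w \<in> {w. 1 + a * w \<noteq> 0}. w / (1 + a * w) \<in> param_inf -` U}"
    then show "((\<phi> \<circ> param_inf) \<circ> (\<lambda>w. w / (1 + a * w))) w = \<phi> (affine_param x w)"
      by (auto simp: affine_param_def param_inf_def Some field_simps)
  qed
  show ?thesis unfolding Some affine_param_vimage_eq
    using 1 2 U(1) unfolding Some
    by (intro holomorphic_on_Un open_shifted_inverse_vimage open_moebius_vimage
        open_Some_vimage open_param_inf_vimage)
qed

lemma openin_sphere_top_minus_finite:
  assumes "finite X"
  shows "openin sphere_top (- X)"
proof -
  have "finite (Some -` X)" "finite (param_inf -` X)"
    using assms inj_affine_param[of "Some 0"]
    by (auto intro!: finite_vimageI simp: affine_param_Some_0)
  then show ?thesis
    by (simp add: openin_sphere_top_iff vimage_Compl finite_imp_closed open_Compl)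
qed

lemma holo_map_openin_vimage:
  assumes "holo_map f" "openin sphere_top U"
  shows "openin sphere_top (f -` U)"
proof -
  have "topspace sphere_top = UNIV" by (simp add: UNIV_option_conv)
  then show ?thesis
    using assms openin_continuous_map_preimage[of sphere_top sphere_top f U]
    by (simp add: holo_map_def vimage_def)
qed

lemma holo_map_id: "holo_map (\<lambda>p. p)"
proof -
  have a: "Some -` range Some = (UNIV :: complex set)"
    "param_inf -` range Some = - {0}" "Some -` (- {Some 0}) = - {0 :: complex}"
    "param_inf -` (- {Some 0}) = UNIV"
    by (auto simp: param_inf_def)
  have op: "openin sphere_top (range Some)" "openin sphere_top (- {Some 0})"
    by (simp_all add: openin_sphere_top_iff a open_Compl)
  have 1: "(the \<circ> Some) holomorphic_on (UNIV :: complex set)" "(chart_inf \<circ> param_inf) holomorphic_on UNIV"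
    by (auto simp: o_def chart_inf_def param_inf_def if_distrib[of "case_option _ _"] cong: if_cong)
  have 2: "(the \<circ> param_inf) holomorphic_on - {0}" "(chart_inf \<circ> Some) holomorphic_on - {0}"
    by (rule holomorphic_transform[of inverse], 
        auto intro!: holomorphic_intros simp: chart_inf_def param_inf_def)+
  show ?thesis
    unfolding holo_map_def sphere_charts_def holo_fun_on_def using op 1 2
    by (simp add: a o_def)
qed

text \<open>The coordinate with pole at \<open>a\<close> is \<open>1 / (z - a)\<close> in terms of the first chart \<open>z\<close> and
  \<open>u / (1 - a * u)\<close> in terms of the second chart \<open>u\<close>. Its only singularity is at \<open>a\<close>. Stating this for
  an arbitrary parametrization \<open>T\<close> of part of the source covers both source charts at once.\<close>

lemma holo_fun_on_affine_coord_Some: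
  fixes T :: "complex \<Rightarrow> rsphere"
  assumes hol: "(\<lambda>w. the (f (T w))) holomorphic_on T -` f -` range Some"
    "(\<lambda>w. chart_inf (f (T w))) holomorphic_on T -` f -` (- {Some 0})"
    and op: "\<And>X. finite X \<Longrightarrow> open (T -` f -` (- X))"
  shows "(\<lambda>w. affine_coord (Some a) (f (T w))) holomorphic_on T -` f -` (- {Some a})"
proof -
  let ?A = "T -` f -` (- {None, Some a})" and ?B = "T -` f -` (- {Some 0, Some a})"
  have 1: "(\<lambda>w. affine_coord (Some a) (f (T w))) holomorphic_on ?A"
  proof (rule holomorphic_transform)
    show "(\<lambda>w. inverse (the (f (T w)) - a)) holomorphic_on ?A"
      by (intro holomorphic_intros holomorphic_on_subset[OF hol(1)]) auto
  qed (auto simp: affine_coord_def split: option.splits)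
  have 2: "(\<lambda>w. affine_coord (Some a) (f (T w))) holomorphic_on ?B"
  proof (rule holomorphic_transform)
    show "(\<lambda>w. chart_inf (f (T w)) / (1 - a * chart_inf (f (T w)))) holomorphic_on ?B"
      by (intro holomorphic_intros holomorphic_on_subset[OF hol(2)])
        (auto simp: chart_inf_def field_simps split: option.splits)
  qed (auto simp: affine_coord_def chart_inf_def field_simps split: option.splits)
  have "(\<lambda>w. affine_coord (Some a) (f (T w))) holomorphic_on (?A \<union> ?B)"
    by (intro holomorphic_on_Un 1 2 op) auto
  moreover have "T -` f -` (- {Some a}) = ?A \<union> ?B" by auto
  ultimately show ?thesis by simp
qed

lemma holo_fun_on_affine_coord:
  assumes "holo_map f"
  shows "holo_fun_on (\<lambda>p. affine_coord y (f p)) (f -` (- {y}))"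
proof (cases y)
  case None
  then have "- {y} = range Some" by auto (metis not_None_eq rangeI)
  then show ?thesis
    using assms None by (auto simp: holo_map_def sphere_charts_def affine_coord_None o_def)
next
  case (Some a)
  have "holo_fun_on (the \<circ> f) (f -` range Some)" "holo_fun_on (chart_inf \<circ> f) (f -` (- {Some 0}))"
    using assms by (auto simp: holo_map_def sphere_charts_def)
  then show ?thesis
    unfolding holo_fun_on_def Some o_def
    by (intro conjI holo_fun_on_affine_coord_Some open_Some_vimage open_param_inf_vimage
        holo_map_openin_vimage[OF assms] openin_sphere_top_minus_finite) auto
qed

lemma
  assumes "holo_map f"
  shows holo_map_in_affine_coords:
      "(\<lambda>w. affine_coord y (f (affine_param x w))) holomorphic_on {w. f (affine_param x w) \<noteq> y}"
    and open_affine_coord_domain: "open {w. f (affine_param x w) \<noteq> y}"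
proof -
  have eq: "{w. f (affine_param x w) \<noteq> y} = affine_param x -` f -` (- {y})" by auto
  show "(\<lambda>w. affine_coord y (f (affine_param x w))) holomorphic_on {w. f (affine_param x w) \<noteq> y}"
    unfolding eq using holo_fun_on_affine_param[OF holo_fun_on_affine_coord[OF assms]] .
  show "open {w. f (affine_param x w) \<noteq> y}"
    unfolding eq
    by (intro open_affine_param_vimage holo_map_openin_vimage[OF assms]
        openin_sphere_top_minus_finite) auto
qed

section \<open>The ramification index as an order of vanishing\<close>

text \<open>An injective holomorphic function has a non-zero derivative, so a local coordinate is comparable
  with the affine one.\<close>

lemma local_coord_in_affine_coord:
  assumes \<phi>: "local_coord q U \<phi>" and "q \<noteq> x"
  obtains l where "l \<noteq> 0"
    and "((\<lambda>w. \<phi> (affine_param x w) / (w - affine_coord x q)) \<longlongrightarrow> l) (at (affine_coord x q))"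
    and "\<forall>\<^sub>F w in at (affine_coord x q). affine_param x w \<in> U \<and> \<phi> (affine_param x w) \<noteq> 0"
proof -
  define N where "N = affine_param x -` U"
  define g where "g w = \<phi> (affine_param x w)" for w
  define w0 where "w0 = affine_coord x q"
  have U: "q \<in> U" "holo_fun_on \<phi> U" "inj_on \<phi> U" "\<phi> q = 0"
    using \<phi> by (auto simp: local_coord_def)
  have T: "affine_param x w0 = q" using \<open>q \<noteq> x\<close> by (simp add: w0_def)
  then have w0: "w0 \<in> N" "g w0 = 0" using U by (auto simp: N_def g_def)
  have N: "open N" using U(2) by (auto simp: N_def holo_fun_on_def intro: open_affine_param_vimage)
  have g: "g holomorphic_on N"
    unfolding g_def N_def by (rule holo_fun_on_affine_param[OF U(2)])
  have inj: "inj_on g N"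
    unfolding g_def N_def using U(3) inj_affine_param[of x]
    by (auto simp: inj_on_def)
  have "deriv g w0 \<noteq> 0" by (rule holomorphic_injective_imp_regular[OF g N inj w0(1)])
  moreover have "(g has_field_derivative deriv g w0) (at w0)"
    using g N w0(1) by (rule holomorphic_derivI)
  then have "((\<lambda>w. g w / (w - w0)) \<longlongrightarrow> deriv g w0) (at w0)"
    by (simp add: has_field_derivative_iff w0(2))
  moreover have "\<forall>\<^sub>F w in at w0. affine_param x w \<in> U \<and> g w \<noteq> 0"
    using eventually_at_in_open[OF N w0(1)]
  proof eventually_elim
    case (elim w)
    then have "g w \<noteq> g w0" using inj w0(1) by (auto simp: inj_on_def)
    then show ?case using elim w0(2) by (simp add: N_def)
  qed
  ultimately show ?thesis using that unfolding g_def w0_def by blast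
qed

text \<open>The exponent of a local power form is the exact order to which \<open>f\<close> attains its value, measured
  in any affine coordinates: from \<open>\<psi> (f p) = \<phi> p ^ e\<close> the two coordinates \<open>\<phi>\<close> and \<open>\<psi>\<close> can be
  replaced by affine ones at the cost of non-zero factors. A limit rather than a power series
  expresses the order, as only growth rates are compared later.\<close>

lemma local_power_form_order:
  assumes f: "holo_map f" and form: "local_power_form f q e" and "q \<noteq> x" "f q \<noteq> y"
  obtains l where "l \<noteq> 0"
    and "((\<lambda>w. (affine_coord y (f (affine_param x w)) - affine_coord y (f q)) /
            (w - affine_coord x q) ^ e) \<longlongrightarrow> l) (at (affine_coord x q))"
proof -
  define G where "G w = affine_coord y (f (affine_param x w))" for w
  define N where "N = {w. f (affine_param x w) \<noteq> y}"
  define w0 where "w0 = affine_coord x q"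
  define u0 where "u0 = affine_coord y (f q)"
  have N: "open N" "w0 \<in> N" and G: "G holomorphic_on N"
    using holo_map_in_affine_coords[OF f, of y x] open_affine_coord_domain[OF f, of x y] assms unfolding N_def G_def w0_def by auto
  have Gw0: "G w0 = u0" using \<open>q \<noteq> x\<close> by (simp add: G_def w0_def u0_def)
  obtain U \<phi> V \<psi> where \<phi>: "local_coord q U \<phi>" and \<psi>: "local_coord (f q) V \<psi>"
    and eq: "\<And>p. p \<in> U \<Longrightarrow> \<psi> (f p) = \<phi> p ^ e"
    using form by (auto simp: local_power_form_def)
  obtain l1 where l1: "l1 \<noteq> 0"
    "((\<lambda>w. \<phi> (affine_param x w) / (w - w0)) \<longlongrightarrow> l1) (at w0)"
    "\<forall>\<^sub>F w in at w0. affine_param x w \<in> U \<and> \<phi> (affine_param x w) \<noteq> 0"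
    using local_coord_in_affine_coord[OF \<phi> \<open>q \<noteq> x\<close>] unfolding w0_def by blast
  obtain l2 where l2: "l2 \<noteq> 0"
    "((\<lambda>u. \<psi> (affine_param y u) / (u - u0)) \<longlongrightarrow> l2) (at u0)"
    using local_coord_in_affine_coord[OF \<psi> \<open>f q \<noteq> y\<close>] unfolding u0_def by blast
  have "\<psi> (affine_param y u0) = 0"
    using \<psi> \<open>f q \<noteq> y\<close> by (simp add: u0_def local_coord_def)
  have ev: "\<forall>\<^sub>F w in at w0. w \<noteq> w0 \<and> \<psi> (affine_param y (G w)) = \<phi> (affine_param x w) ^ e \<and> G w \<noteq> u0"
    using l1(3) eventually_at_in_open[OF N]
  proof eventually_elim
    case (elim w)
    then have "affine_param y (G w) = f (affine_param x w)" by (simp add: G_def N_def)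
    then have "\<psi> (affine_param y (G w)) = \<phi> (affine_param x w) ^ e" using elim eq by simp
    moreover from this have "G w \<noteq> u0"
      using \<open>\<psi> (affine_param y u0) = 0\<close> elim by auto
    ultimately show ?case using elim by simp
  qed
  \<comment> \<open>The limit for \<open>\<psi>\<close> is a punctured one. Composing it with \<open>G\<close> is legitimate as \<open>G\<close> omits
    the value \<open>u0\<close> near \<open>w0\<close>.\<close>
  have "(G \<longlongrightarrow> u0) (at w0)"
    using G N Gw0 by (metis continuous_on_eq_continuous_at holomorphic_on_imp_continuous_on isContD)
  then have "filterlim G (at u0) (at w0)"
    using ev by (auto simp: filterlim_at elim: eventually_mono)
  from filterlim_compose[OF l2(2) this]
  have "((\<lambda>w. (\<phi> (affine_param x w) / (w - w0)) ^ e /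
      (\<psi> (affine_param y (G w)) / (G w - u0))) \<longlongrightarrow> l1 ^ e / l2) (at w0)"
    by (intro tendsto_intros l1 l2)
  moreover have "\<forall>\<^sub>F w in at w0. (\<phi> (affine_param x w) / (w - w0)) ^ e /
      (\<psi> (affine_param y (G w)) / (G w - u0)) = (G w - u0) / (w - w0) ^ e"
    using ev l1(3) by eventually_elim (simp add: power_divide)
  ultimately have "((\<lambda>w. (G w - u0) / (w - w0) ^ e) \<longlongrightarrow> l1 ^ e / l2) (at w0)"
    by (rule Lim_transform_eventually)
  then show ?thesis
    using that[of "l1 ^ e / l2"] l1(1) l2(1) by (simp add: G_def u0_def w0_def)
qed

lemma order_of_vanishing_unique:
  fixes G :: "complex \<Rightarrow> complex"
  assumes "((\<lambda>w. G w / (w - w0) ^ m) \<longlongrightarrow> l) (at w0)" "((\<lambda>w. G w / (w - w0) ^ n) \<longlongrightarrow> l') (at w0)"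
    and "l \<noteq> 0"
  shows "n \<le> m"
proof (rule ccontr)
  assume "\<not> n \<le> m"
  then obtain j where j: "n = m + j" "j > 0" by (metis less_imp_add_positive not_le)
  have "((\<lambda>w. G w / (w - w0) ^ n * (w - w0) ^ j) \<longlongrightarrow> l' * (w0 - w0) ^ j) (at w0)"
    by (intro tendsto_intros assms)
  moreover have "\<forall>\<^sub>F w in at w0. G w / (w - w0) ^ n * (w - w0) ^ j = G w / (w - w0) ^ m"
    by (simp add: eventually_at_filter j power_add)
  ultimately have "((\<lambda>w. G w / (w - w0) ^ m) \<longlongrightarrow> l' * (w0 - w0) ^ j) (at w0)"
    by (rule Lim_transform_eventually)
  with assms(1) have "l = l' * (w0 - w0) ^ j" by (intro tendsto_unique[of "at w0"]) auto
  then show False using j \<open>l \<noteq> 0\<close> by simp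
qed

lemma local_power_form_unique:
  assumes "holo_map f" "local_power_form f q m" "local_power_form f q n"
  shows "m = n"
proof -
  obtain x where x: "x \<noteq> q" using exists_other_point by blast
  obtain y where y: "y \<noteq> f q" using exists_other_point by blast
  obtain l where l: "l \<noteq> 0"
    "((\<lambda>w. (affine_coord y (f (affine_param x w)) - affine_coord y (f q)) /
        (w - affine_coord x q) ^ m) \<longlongrightarrow> l) (at (affine_coord x q))"
    using local_power_form_order[OF assms(1,2) x[symmetric] y[symmetric]] .
  obtain l' where l': "l' \<noteq> 0"
    "((\<lambda>w. (affine_coord y (f (affine_param x w)) - affine_coord y (f q)) /
        (w - affine_coord x q) ^ n) \<longlongrightarrow> l') (at (affine_coord x q))"
    using local_power_form_order[OF assms(1,3) x[symmetric] y[symmetric]] .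
  show ?thesis
    using order_of_vanishing_unique[OF l(2) l'(2) l(1)]
      order_of_vanishing_unique[OF l'(2) l(2) l'(1)] by simp
qed

text \<open>The coordinates vanish at \<open>q\<close> and at \<open>f q\<close>, while a zeroth power would be one.\<close>

lemma local_power_form_pos:
  assumes "local_power_form f q e"
  shows "e \<ge> 1"
proof (rule ccontr)
  assume "\<not> e \<ge> 1"
  then show False using assms by (auto simp: local_power_form_def local_coord_def)
qed

lemma holo_fun_on_compose_affine_coord:
  assumes "g holomorphic_on S" "open S"
  shows "holo_fun_on (\<lambda>p. g (affine_coord x p)) (affine_param x ` S)"
proof -
  note hol = holo_map_in_affine_coords[OF holo_map_id, of x]
    and dom = open_affine_coord_domain[OF holo_map_id]
  have eq: "affine_param z -` affine_param x ` S =
    {w. affine_param z w \<noteq> x} \<inter> (\<lambda>w. affine_coord x (affine_param z w)) -` S" for z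
    by (auto simp: image_iff) (metis affine_param_coord)
  have "open (affine_param z -` affine_param x ` S)" for z
    unfolding eq
    by (intro continuous_open_preimage holomorphic_on_imp_continuous_on hol dom assms)
  moreover have "(\<lambda>w. g (affine_coord x (affine_param z w))) holomorphic_on
      (affine_param z -` affine_param x ` S)" for z
    unfolding eq
    by (rule holomorphic_on_compose_gen[OF holomorphic_on_subset[OF hol] assms(1), unfolded o_def])
      auto
  from this[of None] this[of "Some 0"] calculation[of None] calculation[of "Some 0"]
  show ?thesis
    by (simp add: holo_fun_on_def o_def affine_param_None affine_param_Some_0 openin_sphere_top_iff)
qed

text \<open>In affine coordinates \<open>f - f q\<close> equals \<open>(w - w0) ^ n * g w\<close> with \<open>g\<close> zero-free on a disc. There
  \<open>g\<close> has a logarithm, hence an \<open>n\<close>-th root, and \<open>f - f q\<close> is the \<open>n\<close>-th power of a function with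
  a simple zero, which serves as the local coordinate. Finiteness of the fibre excludes that \<open>f\<close> is
  locally constant at \<open>q\<close>.\<close>

lemma local_power_form_exists:
  assumes f: "holo_map f" and fin: "finite (f -` {f q})"
  obtains e where "local_power_form f q e"
proof -
  obtain x where x: "x \<noteq> q" using exists_other_point by blast
  obtain y where y: "y \<noteq> f q" using exists_other_point by blast
  define G where "G w = affine_coord y (f (affine_param x w))" for w
  define N where "N = {w. f (affine_param x w) \<noteq> y}"
  define w0 where "w0 = affine_coord x q"
  define u0 where "u0 = affine_coord y (f q)"
  have N: "open N" "w0 \<in> N" and G: "G holomorphic_on N"
    using holo_map_in_affine_coords[OF f, of y x] open_affine_coord_domain[OF f, of x y] x y unfolding N_def G_def w0_def by auto
  have Tw0: "affine_param x w0 = q" using x by (simp add: w0_def)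
  then have Gw0: "G w0 = u0" by (simp add: G_def u0_def)
  obtain \<rho> where \<rho>: "\<rho> > 0" "ball w0 \<rho> \<subseteq> N" using N by (meson open_contains_ball)
  have "\<not> (\<lambda>w. G w - u0) constant_on ball w0 \<rho>"
  proof
    assume "(\<lambda>w. G w - u0) constant_on ball w0 \<rho>"
    then obtain c where c: "\<And>w. w \<in> ball w0 \<rho> \<Longrightarrow> G w - u0 = c" by (auto simp: constant_on_def)
    have "f (affine_param x w) = f q" if "w \<in> ball w0 \<rho>" for w
    proof -
      have "G w = u0" using c[OF that] c[of w0] \<rho>(1) Gw0 by simp
      moreover have "f (affine_param x w) \<noteq> y" using that \<rho>(2) by (auto simp: N_def)
      ultimately show ?thesis
        using y by (simp add: G_def u0_def affine_coord_eq_iff)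
    qed
    then have "affine_param x ` ball w0 \<rho> \<subseteq> f -` {f q}" by auto
    then have "finite (affine_param x ` ball w0 \<rho>)" using fin finite_subset by blast
    then have "finite (ball w0 \<rho>)"
      using inj_affine_param by (metis finite_imageD inj_on_subset top_greatest)
    then show False using \<rho>(1) uncountable_ball countable_finite by blast
  qed
  moreover have "(\<lambda>w. G w - u0) holomorphic_on ball w0 \<rho>"
    by (intro holomorphic_intros holomorphic_on_subset[OF G \<rho>(2)])
  ultimately obtain g \<sigma> n where n: "0 < n" "0 < \<sigma>" "ball w0 \<sigma> \<subseteq> ball w0 \<rho>"
    "g holomorphic_on ball w0 \<sigma>" "\<And>w. w \<in> ball w0 \<sigma> \<Longrightarrow> G w - u0 = (w - w0) ^ n * g w"
    "\<And>w. w \<in> ball w0 \<sigma> \<Longrightarrow> g w \<noteq> 0"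
    using holomorphic_factor_zero_nonconstant[of "\<lambda>w. G w - u0" "ball w0 \<rho>" w0 thesis] \<rho>(1) Gw0
    by auto
  obtain h where h: "h holomorphic_on ball w0 \<sigma>" "\<And>w. w \<in> ball w0 \<sigma> \<Longrightarrow> g w = exp (h w)"
    using contractible_imp_holomorphic_log[OF n(4) _ n(6)] by (auto simp: convex_imp_contractible)
  define \<Phi> where "\<Phi> w = (w - w0) * exp (h w / n)" for w
  have \<Phi>: "\<Phi> holomorphic_on ball w0 \<sigma>"
    unfolding \<Phi>_def by (intro holomorphic_intros h) (use n(1) in auto)
  have pow: "\<Phi> w ^ n = G w - u0" if "w \<in> ball w0 \<sigma>" for w
    using that n h by (simp add: \<Phi>_def power_mult_distrib flip: exp_of_nat_mult)
  have "((\<lambda>w. exp (h w / n)) \<longlongrightarrow> exp (h w0 / n)) (at w0)"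
    using holomorphic_on_imp_continuous_on[OF h(1)] n(1,2)
    by (intro tendsto_intros) (auto simp: continuous_on_eq_continuous_at isContD)
  then have "(\<Phi> has_field_derivative exp (h w0 / n)) (at w0)"
    unfolding has_field_derivative_iff
    by (rule Lim_transform_eventually) (simp add: eventually_at_filter \<Phi>_def)
  then have "deriv \<Phi> w0 \<noteq> 0" by (simp add: DERIV_imp_deriv)
  then obtain s where s: "s > 0" "ball w0 s \<subseteq> ball w0 \<sigma>" "inj_on \<Phi> (ball w0 s)"
    using has_complex_derivative_locally_injective[OF \<Phi>, of w0] n(2) by auto
  have "local_coord q (affine_param x ` ball w0 s) (\<lambda>p. \<Phi> (affine_coord x p))"
    unfolding local_coord_def
  proof (intro conjI)
    show "q \<in> affine_param x ` ball w0 s" using Tw0 s(1) by force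
    show "holo_fun_on (\<lambda>p. \<Phi> (affine_coord x p)) (affine_param x ` ball w0 s)"
      by (intro holo_fun_on_compose_affine_coord holomorphic_on_subset[OF \<Phi> s(2)]) auto
    show "inj_on (\<lambda>p. \<Phi> (affine_coord x p)) (affine_param x ` ball w0 s)"
      using s(3) by (auto simp: inj_on_def)
    show "\<Phi> (affine_coord x q) = 0" by (simp add: \<Phi>_def w0_def)
  qed
  moreover have "local_coord (f q) (affine_param y ` UNIV) (\<lambda>p. affine_coord y p - u0)"
    unfolding local_coord_def
  proof (intro conjI)
    show "f q \<in> range (affine_param y)" using y by (metis affine_param_coord rangeI)
    show "holo_fun_on (\<lambda>p. affine_coord y p - u0) (range (affine_param y))"
      by (intro holo_fun_on_compose_affine_coord[of "\<lambda>u. u - u0"] holomorphic_intros) auto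
  qed (auto simp: inj_on_def u0_def)
  moreover have "f (affine_param x w) = affine_param y (G w)" if "w \<in> ball w0 s" for w
  proof -
    have "w \<in> N" using that s(2) n(3) \<rho>(2) by blast
    then show ?thesis by (simp add: G_def N_def)
  qed
  ultimately have "local_power_form f q n"
    unfolding local_power_form_def
    by (intro exI[of _ "affine_param x ` ball w0 s"] exI[of _ "range (affine_param y)"]
        exI[of _ "\<lambda>p. \<Phi> (affine_coord x p)"] exI[of _ "\<lambda>p. affine_coord y p - u0"])
      (use s(2) pow in auto)
  then show ?thesis using that by blast
qed

lemma local_power_form_ram_index:
  assumes "holo_map f" "finite (f -` {f q})"
  shows "local_power_form f q (ram_index f q)"
  unfolding ram_index_def
  using local_power_form_exists[OF assms] local_power_form_unique[OF assms(1)]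
  by (metis theI)

section \<open>Contact of a rational power with a constant\<close>

text \<open>In \<open>P ^ r - Q ^ r = (P - Q) * R\<close> the factor \<open>R\<close> is a sum of \<open>r\<close> monic polynomials of degree
  \<open>(r - 1) * k\<close>, whose leading terms add up to \<open>r \<noteq> 0\<close>.\<close>

lemma degree_diff_powers_monic:
  fixes P Q :: "complex poly"
  assumes "lead_coeff P = 1" "lead_coeff Q = 1" "degree P = k" "degree Q = k" "P \<noteq> Q" "r \<ge> 1"
  shows "P ^ r - Q ^ r \<noteq> 0" "(r - 1) * k \<le> degree (P ^ r - Q ^ r)"
proof -
  define R where "R = (\<Sum>i<r. Q ^ (r - Suc i) * P ^ i)"
  have PQ: "P \<noteq> 0" "Q \<noteq> 0" using assms by auto
  have "coeff (Q ^ (r - Suc i) * P ^ i) ((r - 1) * k) = 1" if "i < r" for i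
  proof -
    have "r - 1 = (r - Suc i) + i" using that by simp
    then have "degree (Q ^ (r - Suc i) * P ^ i) = (r - 1) * k"
      using PQ assms(3,4) by (simp add: degree_mult_eq degree_power_eq algebra_simps)
    moreover have "lead_coeff (Q ^ (r - Suc i) * P ^ i) = 1"
      using assms(1,2) by (simp add: lead_coeff_mult lead_coeff_power)
    ultimately show ?thesis by simp
  qed
  then have "coeff R ((r - 1) * k) = of_nat r" by (simp add: R_def coeff_sum)
  then have R: "coeff R ((r - 1) * k) \<noteq> 0" using \<open>r \<ge> 1\<close> by simp
  then have "R \<noteq> 0" "(r - 1) * k \<le> degree R" by (auto intro: le_degree)
  moreover have eq: "P ^ r - Q ^ r = (P - Q) * R"
    unfolding R_def by (rule power_diff_sumr2)
  ultimately show "P ^ r - Q ^ r \<noteq> 0" "(r - 1) * k \<le> degree (P ^ r - Q ^ r)"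
    using \<open>P \<noteq> Q\<close> by (simp_all add: degree_mult_eq)
qed

lemma eventually_at_notin_finite:
  fixes z :: "'a :: t1_space"
  assumes "finite X"
  shows "\<forall>\<^sub>F w in at z. w \<notin> X"
proof -
  have "open (- (X - {z}))" by (intro open_Compl finite_imp_closed finite_Diff assms)
  from eventually_at_in_open[OF this, of z] show ?thesis
    by (auto elim: eventually_mono)
qed

lemma eventually_at_infinity_notin_finite:
  fixes X :: "'a :: real_normed_vector set"
  assumes "finite X"
  shows "\<forall>\<^sub>F w in at_infinity. w \<notin> X"
proof -
  obtain R where "\<And>w. w \<in> X \<Longrightarrow> norm w \<le> R"
    using finite_imp_bounded[OF assms] by (auto simp: bounded_iff)
  then show ?thesis
    unfolding eventually_at_infinity by (intro exI[of _ "R + 1"]) force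
qed

lemma tendsto_monic_quotient_at_infinity:
  fixes P Q :: "complex poly"
  assumes "lead_coeff P = 1" "lead_coeff Q = 1" "degree P = degree Q"
  shows "((\<lambda>w. poly Q w / poly P w) \<longlongrightarrow> 1) at_infinity"
proof -
  have "((\<lambda>w. (poly Q w / w ^ degree Q) / (poly P w / w ^ degree P)) \<longlongrightarrow> lead_coeff Q / lead_coeff P)
      at_infinity"
    by (intro tendsto_divide poly_divide_tendsto_aux) (use assms in auto)
  moreover have "\<forall>\<^sub>F w in at_infinity.
      (poly Q w / w ^ degree Q) / (poly P w / w ^ degree P) = poly Q w / poly P w"
    using eventually_at_infinity_notin_finite[of "{0}"]
    by (rule eventually_mono) (use assms in auto)
  ultimately have "((\<lambda>w. poly Q w / poly P w) \<longlongrightarrow> lead_coeff Q / lead_coeff P) at_infinity"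
    by (rule Lim_transform_eventually)
  then show ?thesis unfolding assms(1,2) by simp
qed

text \<open>Riemann's removable singularity theorem followed by Liouville's theorem.\<close>

lemma removable_singularities_constant:
  fixes E :: "complex \<Rightarrow> complex"
  assumes "finite X" and hol: "E holomorphic_on - X"
    and lim: "\<And>z. z \<in> X \<Longrightarrow> \<exists>l. (E \<longlongrightarrow> l) (at z)"
    and inf: "(E \<longlongrightarrow> c) at_infinity" and "w \<notin> X"
  shows "E w = c"
proof -
  obtain L where L: "\<And>z. z \<in> X \<Longrightarrow> (E \<longlongrightarrow> L z) (at z)" using lim by metis
  define E' where "E' w = (if w \<in> X then L w else E w)" for w
  have "E' holomorphic_on UNIV"
  proof (rule no_isolated_singularity'[of X])
    fix z assume z: "z \<in> X"
    have "\<forall>\<^sub>F w in at z. E w = E' w"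
      using eventually_at_notin_finite[OF \<open>finite X\<close>] by (rule eventually_mono) (simp add: E'_def)
    from Lim_transform_eventually[OF L[OF z] this] show "(E' \<longlongrightarrow> E' z) (at z)"
      using z unfolding E'_def[of z] by simp
  next
    show "E' holomorphic_on UNIV - X"
      by (rule holomorphic_transform[of E])
        (use hol in \<open>auto simp: E'_def Compl_eq_Diff_UNIV\<close>)
  qed (use \<open>finite X\<close> in auto)
  moreover have "(E' \<longlongrightarrow> c) at_infinity"
  proof (rule Lim_transform_eventually[OF inf])
    show "\<forall>\<^sub>F w in at_infinity. E w = E' w"
      using eventually_at_infinity_notin_finite[OF \<open>finite X\<close>]
      by (rule eventually_mono) (simp add: E'_def)
  qed
  ultimately have "E' w = c" by (rule Liouville_weak)
  then show ?thesis using \<open>w \<notin> X\<close> by (simp add: E'_def)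
qed

lemma monic_root_product:
  assumes "finite X"
  shows "lead_coeff (\<Prod>a\<in>X. [:- a, 1:]) = (1 :: complex)" "degree (\<Prod>a\<in>X. [:- a, 1:]) = card X"
    "poly (\<Prod>a\<in>X. [:- a, 1:]) w = 0 \<longleftrightarrow> w \<in> X"
  using assms by (simp_all only: lead_coeff_prod) (simp_all add: degree_prod_eq_sum_degree poly_prod)

text \<open>The hypotheses \<open>zeros\<close> and \<open>poles\<close> bound the divisor of \<open>F\<close> on one side only: zeros of order at
  least \<open>r\<close> at \<open>A\<close> and poles of order at most \<open>r\<close> at \<open>B\<close>. As \<open>A\<close> and \<open>B\<close> have the same number of
  elements, this already makes \<open>E = F * (Q / P) ^ r\<close> bounded, hence constant, where \<open>P\<close> and \<open>Q\<close> are
  the monic polynomials with simple roots at \<open>A\<close> and \<open>B\<close>. The hypothesis \<open>contact\<close> says that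
  \<open>F - c = c * (P ^ r - Q ^ r) / Q ^ r\<close> vanishes at infinity to order at least \<open>e\<close>.\<close>

lemma contact_order_at_infinity_le:
  fixes F :: "complex \<Rightarrow> complex" and A B :: "complex set"
  assumes A: "finite A" "card A = k" and B: "finite B" "card B = k"
    and disj: "A \<inter> B = {}" and "k \<ge> 1" "r \<ge> 1"
    and hol: "F holomorphic_on - (A \<union> B)"
    and zeros: "\<And>a. a \<in> A \<Longrightarrow> \<exists>l. ((\<lambda>w. F w / (w - a) ^ r) \<longlongrightarrow> l) (at a)"
    and poles: "\<And>b. b \<in> B \<Longrightarrow> \<exists>l. ((\<lambda>w. F w * (w - b) ^ r) \<longlongrightarrow> l) (at b)"
    and contact: "((\<lambda>w. (F w - c) * (w - w1) ^ e) \<longlongrightarrow> l) at_infinity" and "e \<ge> 1" "c \<noteq> 0"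
  shows "e \<le> k"
proof (rule ccontr)
  assume "\<not> e \<le> k"
  define p where "p X = (\<Prod>a\<in>X. [:- a, 1:])" for X :: "complex set"
  define P where "P = p A"
  define Q where "Q = p B"
  define E where "E w = F w * (poly Q w / poly P w) ^ r" for w
  note p = monic_root_product[folded p_def]
  have P: "lead_coeff P = 1" "degree P = k" "\<And>w. poly P w = 0 \<longleftrightarrow> w \<in> A"
    and Q: "lead_coeff Q = 1" "degree Q = k" "\<And>w. poly Q w = 0 \<longleftrightarrow> w \<in> B"
    using p[OF A(1)] p[OF B(1)] A B by (simp_all add: P_def Q_def)
  have p_remove: "poly (p X) w = (w - a) * poly (p (X - {a})) w" if "finite X" "a \<in> X" for X a w
  proof -
    have "p X = [:- a, 1:] * p (X - {a})" unfolding p_def by (rule prod.remove[OF that])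
    then show ?thesis by (simp only: poly_mult) simp
  qed
  have E_lim: "\<exists>l. (E \<longlongrightarrow> l) (at z)" if "z \<in> A \<union> B" for z
  proof (cases "z \<in> A")
    case True
    obtain l where "((\<lambda>w. F w / (w - z) ^ r) \<longlongrightarrow> l) (at z)" using zeros[OF True] by blast
    then have "((\<lambda>w. F w / (w - z) ^ r * (poly Q w / poly (p (A - {z})) w) ^ r) \<longlongrightarrow>
        l * (poly Q z / poly (p (A - {z})) z) ^ r) (at z)"
      using p(3)[of "A - {z}" z] A(1) by (intro tendsto_intros) auto
    moreover have "F w / (w - z) ^ r * (poly Q w / poly (p (A - {z})) w) ^ r = E w" for w
      by (simp add: E_def P_def p_remove[OF A(1) True] power_mult_distrib power_divide)
    ultimately show ?thesis by auto
  next
    case False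
    then have z: "z \<in> B" using that by simp
    obtain l where "((\<lambda>w. F w * (w - z) ^ r) \<longlongrightarrow> l) (at z)" using poles[OF z] by blast
    then have "((\<lambda>w. F w * (w - z) ^ r * (poly (p (B - {z})) w / poly P w) ^ r) \<longlongrightarrow>
        l * (poly (p (B - {z})) z / poly P z) ^ r) (at z)"
      using P(3)[of z] False by (intro tendsto_intros) auto
    moreover have "F w * (w - z) ^ r * (poly (p (B - {z})) w / poly P w) ^ r = E w" for w
      by (simp add: E_def Q_def p_remove[OF B(1) z] power_mult_distrib power_divide)
    ultimately show ?thesis by auto
  qed
  have E_hol: "E holomorphic_on - (A \<union> B)"
    unfolding E_def by (intro holomorphic_intros hol) (simp add: P(3))
  \<comment> \<open>Since \<open>e \<ge> 1\<close>, the contact condition contains the limit of \<open>F\<close> at infinity.\<close>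
  have "((\<lambda>w. poly 1 w / poly ([:- w1, 1:] ^ e) w) \<longlongrightarrow> 0) at_infinity"
    using \<open>e \<ge> 1\<close> by (intro poly_divide_tendsto_0_at_infinity) (simp add: degree_power_eq)
  from tendsto_mult[OF contact this]
  have "((\<lambda>w. (F w - c) * (w - w1) ^ e * (poly 1 w / poly ([:- w1, 1:] ^ e) w)) \<longlongrightarrow> 0) at_infinity"
    by simp
  moreover have "\<forall>\<^sub>F w in at_infinity.
      (F w - c) * (w - w1) ^ e * (poly 1 w / poly ([:- w1, 1:] ^ e) w) = F w - c"
    using eventually_at_infinity_notin_finite[of "{w1}"] by (rule eventually_mono) auto
  ultimately have "((\<lambda>w. F w - c) \<longlongrightarrow> 0) at_infinity"
    by (rule Lim_transform_eventually)
  then have F_lim: "(F \<longlongrightarrow> c) at_infinity" by (rule LIM_zero_cancel)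
  have "(E \<longlongrightarrow> c * 1 ^ r) at_infinity"
    unfolding E_def using P Q
    by (intro tendsto_intros F_lim tendsto_monic_quotient_at_infinity) auto
  then have E_eq: "E w = c" if "w \<notin> A \<union> B" for w
    using removable_singularities_constant[OF _ E_hol E_lim _ that] A(1) B(1) by simp
  \<comment> \<open>The function in the contact condition is \<open>c * D / Q ^ r\<close>. If \<open>e > k\<close>, then \<open>D\<close> has larger
    degree than \<open>Q ^ r\<close>, so this quotient cannot have a finite limit.\<close>
  define D where "D = (P ^ r - Q ^ r) * [:- w1, 1:] ^ e"
  have "P \<noteq> Q"
  proof
    assume "P = Q"
    then have "A = B" using P(3) Q(3) by blast
    then show False using disj A \<open>k \<ge> 1\<close> by auto
  qed
  then have "degree D = degree (P ^ r - Q ^ r) + e" "(r - 1) * k \<le> degree (P ^ r - Q ^ r)"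
    using degree_diff_powers_monic[OF P(1) Q(1) P(2) Q(2) _ \<open>r \<ge> 1\<close>]
    by (simp_all add: D_def degree_mult_eq degree_power_eq)
  moreover have "r * k = (r - 1) * k + k" using \<open>r \<ge> 1\<close> by (cases r) auto
  moreover have "Q \<noteq> 0" using Q(1) by auto
  ultimately have deg: "degree (Q ^ r) < degree D"
    using \<open>\<not> e \<le> k\<close> by (simp add: degree_power_eq Q(2))
  then have "D \<noteq> 0" by auto
  have "((\<lambda>w. (F w - c) * (w - w1) ^ e * (poly (Q ^ r) w / poly D w)) \<longlongrightarrow> l * 0) at_infinity"
    by (intro tendsto_mult contact poly_divide_tendsto_0_at_infinity deg)
  moreover have "finite (A \<union> B \<union> {w. poly D w = 0})"
    using A(1) B(1) poly_roots_finite[OF \<open>D \<noteq> 0\<close>] by simp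
  from eventually_at_infinity_notin_finite[OF this]
  have "\<forall>\<^sub>F w in at_infinity. (F w - c) * (w - w1) ^ e * (poly (Q ^ r) w / poly D w) = c"
  proof eventually_elim
    case (elim w)
    then have w: "w \<notin> A \<union> B" and Dw: "poly D w \<noteq> 0" by auto
    have "F w * (poly Q w) ^ r = c * (poly P w) ^ r"
      using E_eq[OF w] P(3)[of w] w by (simp add: E_def power_divide field_simps)
    then have "(F w - c) * (w - w1) ^ e * poly (Q ^ r) w = c * poly D w"
      by (simp add: D_def algebra_simps)
    then show ?case using Dw by simp
  qed
  ultimately have "((\<lambda>w :: complex. c) \<longlongrightarrow> l * 0) at_infinity"
    by (rule Lim_transform_eventually)
  from tendsto_unique[OF trivial_limit_at_infinity tendsto_const this]
  show False using \<open>c \<noteq> 0\<close> by simp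
qed

section \<open>Branched covers with two homogeneous fibres\<close>

text \<open>The source coordinate has its pole at \<open>q\<close>, so that \<open>q\<close> lies at infinity and both special fibres
  are finite sets of complex numbers. The target coordinate has its pole at \<open>p1\<close> and is shifted to
  vanish at \<open>p0\<close>, giving the function \<open>F\<close> in the proof. Near the fibre over \<open>p1\<close> the coordinate with
  pole at \<open>p0\<close> gives \<open>H\<close>, which is a non-zero multiple of \<open>1 / F\<close>.\<close>

lemma ram_index_le_of_homogeneous_fibres:
  assumes f: "holo_map f" and fin: "\<And>p. finite (f -` {p})"
    and "p0 \<noteq> p1" and q: "f q \<noteq> p0" "f q \<noteq> p1"
    and ram: "\<And>x. f x = p0 \<Longrightarrow> ram_index f x = r" "\<And>x. f x = p1 \<Longrightarrow> ram_index f x = r"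
    and card: "card (f -` {p0}) = k" "card (f -` {p1}) = k" and "k \<ge> 1" "r \<ge> 1"
  shows "ram_index f q \<le> k"
proof -
  define A where "A = affine_coord q ` (f -` {p0})"
  define B where "B = affine_coord q ` (f -` {p1})"
  define F where "F w = affine_coord p1 (f (affine_param q w)) - affine_coord p1 p0" for w
  define H where "H w = affine_coord p0 (f (affine_param q w)) - affine_coord p0 p1" for w
  define c where "c = affine_coord p1 (f q) - affine_coord p1 p0"
  have form: "local_power_form f x (ram_index f x)" for x
    by (rule local_power_form_ram_index[OF f fin])
  have inj: "inj_on (affine_coord q) (f -` {p})" if "p \<noteq> f q" for p
  proof (rule inj_onI)
    fix u v assume "u \<in> f -` {p}" "v \<in> f -` {p}" and eq: "affine_coord q u = affine_coord q v"
    then have "u \<noteq> q" "v \<noteq> q" using that by auto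
    then show "u = v" using eq by (simp add: affine_coord_eq_iff)
  qed
  have A: "finite A" "card A = k" and B: "finite B" "card B = k"
    using fin card inj q unfolding A_def B_def by (auto simp: card_image)
  have mem: "w \<in> affine_coord q ` (f -` {p}) \<longleftrightarrow> f (affine_param q w) = p" if "p \<noteq> f q" for p w
  proof
    assume "w \<in> affine_coord q ` (f -` {p})"
    then obtain u where u: "w = affine_coord q u" "f u = p" by auto
    then have "u \<noteq> q" using that by auto
    then show "f (affine_param q w) = p" using u by simp
  next
    assume "f (affine_param q w) = p"
    then show "w \<in> affine_coord q ` (f -` {p})"
      by (intro image_eqI[of _ _ "affine_param q w"]) auto
  qed
  note memA = mem[OF q(1)[symmetric], folded A_def] and memB = mem[OF q(2)[symmetric], folded B_def]
  obtain x where x: "x \<noteq> q" using exists_other_point by blast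
  obtain l where l: "((\<lambda>v. (affine_coord p1 (f (affine_param x v)) - affine_coord p1 (f q)) /
      (v - affine_coord x q) ^ ram_index f q) \<longlongrightarrow> l) (at (affine_coord x q))"
    using local_power_form_order[OF f form x[symmetric] q(2)] by blast
  obtain K where K: "K \<noteq> 0" "\<And>p. p \<noteq> x \<Longrightarrow> p \<noteq> q \<Longrightarrow>
      (affine_coord x p - affine_coord x q) * (affine_coord q p - affine_coord q x) = K"
    using affine_coord_mult[OF x] by metis
  obtain K' where K': "K' \<noteq> 0" "\<And>p. p \<noteq> p1 \<Longrightarrow> p \<noteq> p0 \<Longrightarrow>
      (affine_coord p1 p - affine_coord p1 p0) * (affine_coord p0 p - affine_coord p0 p1) = K'"
    using affine_coord_mult[OF \<open>p0 \<noteq> p1\<close>[symmetric]] by metis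
  show ?thesis
  proof (rule contact_order_at_infinity_le[OF A B _ \<open>k \<ge> 1\<close> \<open>r \<ge> 1\<close>, of F c "affine_coord q x"])
    show "A \<inter> B = {}" using memA memB \<open>p0 \<noteq> p1\<close> by auto
    show "F holomorphic_on - (A \<union> B)"
      unfolding F_def
      by (intro holomorphic_intros holomorphic_on_subset[OF holo_map_in_affine_coords[OF f]])
        (auto simp: memB)
    show "\<exists>l. ((\<lambda>w. F w / (w - a) ^ r) \<longlongrightarrow> l) (at a)" if "a \<in> A" for a
      using local_power_form_order[OF f form, of "affine_param q a" q p1] that \<open>p0 \<noteq> p1\<close>
      by (auto simp: F_def memA ram)
    show "\<exists>l. ((\<lambda>w. F w * (w - b) ^ r) \<longlongrightarrow> l) (at b)" if "b \<in> B" for b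
    proof -
      have fb: "f (affine_param q b) = p1" using that by (simp add: memB)
      obtain l where l: "l \<noteq> 0" "((\<lambda>w. H w / (w - b) ^ r) \<longlongrightarrow> l) (at b)"
      proof (rule local_power_form_order[OF f form affine_param_neq(1)])
        show "f (affine_param q b) \<noteq> p0" using \<open>p0 \<noteq> p1\<close> fb by simp
        fix l :: complex
        assume "l \<noteq> 0"
          and "((\<lambda>w. (affine_coord p0 (f (affine_param q w)) - affine_coord p0 (f (affine_param q b))) /
            (w - affine_coord q (affine_param q b)) ^ ram_index f (affine_param q b)) \<longlongrightarrow> l)
            (at (affine_coord q (affine_param q b)))"
        then show thesis using that by (simp add: H_def fb ram)
      qed
      have "((\<lambda>w. K' / (H w / (w - b) ^ r)) \<longlongrightarrow> K' / l) (at b)"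
        by (intro tendsto_intros l)
      moreover have "\<forall>\<^sub>F w in at b. K' / (H w / (w - b) ^ r) = F w * (w - b) ^ r"
        using eventually_at_notin_finite[OF A(1)] eventually_at_notin_finite[OF B(1)]
      proof eventually_elim
        case (elim w)
        then have "F w * H w = K'"
          using K'(2)[of "f (affine_param q w)"] by (simp add: F_def H_def memA memB)
        then show ?case using K'(1) by (auto simp: field_simps)
      qed
      ultimately show ?thesis by (blast intro: Lim_transform_eventually)
    qed
    show "((\<lambda>w. (F w - c) * (w - affine_coord q x) ^ ram_index f q) \<longlongrightarrow> l * K ^ ram_index f q) at_infinity"
    proof -
      \<comment> \<open>The order at \<open>q\<close> is known in a coordinate \<open>v\<close> around \<open>q\<close>, and \<open>v - v0 = K / (w - w1)\<close>
        turns vanishing to that order at \<open>v0\<close> into decay at infinity.\<close>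
      define V where "V w = affine_coord x (affine_param q w)" for w
      define v0 where "v0 = affine_coord x q"
      define w1 where "w1 = affine_coord q x"
      have V: "\<forall>\<^sub>F w in at_infinity. w \<noteq> w1 \<and> affine_param q w \<noteq> x \<and> (V w - v0) * (w - w1) = K"
        using eventually_at_infinity_notin_finite[OF finite.insertI[OF finite.emptyI, of w1]]
      proof eventually_elim
        case (elim w)
        then have "affine_param q w \<noteq> x" by (auto simp: w1_def)
        then show ?case using elim K(2)[of "affine_param q w"] by (simp add: V_def v0_def w1_def)
      qed
      have "((\<lambda>w. poly [:K:] w / poly [:- w1, 1:] w) \<longlongrightarrow> 0) at_infinity"
        by (rule poly_divide_tendsto_0_at_infinity) simp
      then have "((\<lambda>w. v0 + poly [:K:] w / poly [:- w1, 1:] w) \<longlongrightarrow> v0 + 0) at_infinity"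
        by (intro tendsto_intros)
      moreover have "\<forall>\<^sub>F w in at_infinity. v0 + poly [:K:] w / poly [:- w1, 1:] w = V w"
        using V by eventually_elim (auto simp: field_simps)
      ultimately have "(V \<longlongrightarrow> v0 + 0) at_infinity" by (rule Lim_transform_eventually)
      moreover have "\<forall>\<^sub>F w in at_infinity. V w \<noteq> v0"
        using V by eventually_elim (use K(1) in auto)
      ultimately have "filterlim V (at v0) at_infinity" by (simp add: filterlim_at)
      from filterlim_compose[OF l[folded v0_def] this]
      have "((\<lambda>w. (affine_coord p1 (f (affine_param x (V w))) - affine_coord p1 (f q)) /
          (V w - v0) ^ ram_index f q * K ^ ram_index f q) \<longlongrightarrow> l * K ^ ram_index f q) at_infinity"
        by (intro tendsto_intros)
      moreover have "\<forall>\<^sub>F w in at_infinity.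
          (affine_coord p1 (f (affine_param x (V w))) - affine_coord p1 (f q)) /
          (V w - v0) ^ ram_index f q * K ^ ram_index f q = (F w - c) * (w - w1) ^ ram_index f q"
        using V
      proof eventually_elim
        case (elim w)
        then have "affine_param x (V w) = affine_param q w" by (simp add: V_def)
        then have Fc: "affine_coord p1 (f (affine_param x (V w))) - affine_coord p1 (f q) = F w - c"
          by (simp add: F_def c_def)
        have "K ^ ram_index f q = (V w - v0) ^ ram_index f q * (w - w1) ^ ram_index f q"
          using elim by (metis power_mult_distrib)
        moreover have "V w - v0 \<noteq> 0" using elim K(1) by auto
        ultimately show ?case unfolding Fc by simp
      qed
      ultimately show ?thesis unfolding w1_def by (rule Lim_transform_eventually)
    qed
    show "ram_index f q \<ge> 1" by (rule local_power_form_pos[OF form])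
    show "c \<noteq> 0" using q \<open>p0 \<noteq> p1\<close> by (simp add: c_def affine_coord_eq_iff)
  qed
qed

lemma realizes_homogeneous_imp_le:
  assumes real: "realizes f d [\<pi>, replicate k r, replicate k r]" and "k \<ge> 1" "r \<ge> 1"
    and "m \<in> set \<pi>"
  shows "m \<le> k"
proof -
  obtain ps where ps: "length ps = 3" "distinct ps"
    and fib: "\<And>i. i < 3 \<Longrightarrow> image_mset (ram_index f) (mset_set (f -` {ps ! i})) =
      mset ([\<pi>, replicate k r, replicate k r] ! i)"
    using real by (auto simp: realizes_def numeral_3_eq_3)
  have f: "holo_map f" and fin: "\<And>p. finite (f -` {p})"
    using real by (auto simp: realizes_def branched_cover_def has_degree_def)
  have hom: "ram_index f x = r" if "f x = ps ! i" "i \<in> {1, 2}" for x i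
  proof -
    have "ram_index f x \<in># image_mset (ram_index f) (mset_set (f -` {ps ! i}))"
      using that(1) fin by simp
    also have "image_mset (ram_index f) (mset_set (f -` {ps ! i})) = mset (replicate k r)"
      using fib[of i] that(2) by auto
    finally show ?thesis by (simp only: set_mset_mset) (simp split: if_splits)
  qed
  have card: "card (f -` {ps ! i}) = k" if "i \<in> {1, 2}" for i
    using arg_cong[OF fib[of i], of size] that by auto
  have "m \<in># image_mset (ram_index f) (mset_set (f -` {ps ! 0}))"
    using fib[of 0] assms(4) by simp
  then obtain q where q: "f q = ps ! 0" "ram_index f q = m" using fin by auto
  have "ps ! 0 \<noteq> ps ! 1" "ps ! 0 \<noteq> ps ! 2" "ps ! 1 \<noteq> ps ! 2"
    using ps by (simp_all add: nth_eq_iff_index_eq)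
  then have "ram_index f q \<le> k"
    using q hom[of _ 1] hom[of _ 2] card[of 1] card[of 2] assms(2,3)
    by (intro ram_index_le_of_homogeneous_fibres[OF f fin, where r = r and ?p0.0 = "ps ! 1" and ?p1.0 = "ps ! 2"]) auto
  then show ?thesis using q by simp
qed

theorem proposition3:
  fixes d r k :: nat
  assumes "d = r * k" and "r \<ge> 2" and "k \<ge> 2"
  shows "exceptional d
           [(2 * k - 1) # replicate ((r - 2) * k + 1) 1, replicate k r, replicate k r] \<and>
         (\<forall>j1 j2 :: nat. j1 \<ge> 1 \<and> j2 \<ge> 1 \<and> j1 \<noteq> j2 \<and> j1 + j2 = 2 * k \<longrightarrow>
           exceptional d
             [j1 # j2 # replicate ((r - 2) * k) 1, replicate k r, replicate k r])"
proof (intro conjI allI impI)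
  have rk: "r * k = (r - 2) * k + 2 * k"
    using assms(2) by (metis add_mult_distrib le_add_diff_inverse2)
  then have rk': "int r * int k = int ((r - 2) * k) + 2 * int k"
    by (metis of_nat_add of_nat_mult of_nat_numeral)
  have hom: "sum_list (replicate k r) = d" "(\<Sum>m\<leftarrow>replicate k r. int m - 1) = int r * int k - int k"
    using assms by (simp_all add: sum_list_replicate algebra_simps)
  have ones: "(\<Sum>m\<leftarrow>replicate n 1. int m - 1) = 0" for n
    by (simp add: sum_list_replicate)
  show "exceptional d [(2 * k - 1) # replicate ((r - 2) * k + 1) 1, replicate k r, replicate k r]"
    unfolding exceptional_def
  proof (intro conjI notI)
    have "sum_list ((2 * k - 1) # replicate ((r - 2) * k + 1) 1) = d"
      using assms(1,3) rk by (simp add: sum_list_replicate)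
    moreover have "(\<Sum>m\<leftarrow>(2 * k - 1) # replicate ((r - 2) * k + 1) 1. int m - 1) = 2 * int k - 2"
      using assms(3) ones by (simp add: of_nat_diff)
    moreover have "2 * k - 1 \<ge> 1" "2 * k - 1 \<ge> 2" using assms(3) by linarith+
    ultimately show "candidate_branch_datum d
        [(2 * k - 1) # replicate ((r - 2) * k + 1) 1, replicate k r, replicate k r]"
      using assms hom rk' unfolding candidate_branch_datum_def by simp
    assume "\<exists>f. realizes f d
        [(2 * k - 1) # replicate ((r - 2) * k + 1) 1, replicate k r, replicate k r]"
    then obtain f where "realizes f d
        [(2 * k - 1) # replicate ((r - 2) * k + 1) 1, replicate k r, replicate k r]" ..
    then have "2 * k - 1 \<le> k"
      by (rule realizes_homogeneous_imp_le) (use assms in auto)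
    then show False using assms by simp
  qed
  fix j1 j2 :: nat
  assume j: "j1 \<ge> 1 \<and> j2 \<ge> 1 \<and> j1 \<noteq> j2 \<and> j1 + j2 = 2 * k"
  show "exceptional d [j1 # j2 # replicate ((r - 2) * k) 1, replicate k r, replicate k r]"
    unfolding exceptional_def
  proof (intro conjI notI)
    have "j1 \<ge> 2 \<or> j2 \<ge> 2" using j by linarith
    moreover have "sum_list (j1 # j2 # replicate ((r - 2) * k) 1) = d"
      using assms(1) rk j by (simp add: sum_list_replicate)
    moreover have "int j1 + int j2 = 2 * int k" using j by linarith
    then have "(\<Sum>m\<leftarrow>j1 # j2 # replicate ((r - 2) * k) 1. int m - 1) = 2 * int k - 2"
      using ones by simp
    ultimately show "candidate_branch_datum d
        [j1 # j2 # replicate ((r - 2) * k) 1, replicate k r, replicate k r]"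
      using assms hom rk' j unfolding candidate_branch_datum_def by simp
    assume "\<exists>f. realizes f d [j1 # j2 # replicate ((r - 2) * k) 1, replicate k r, replicate k r]"
    then obtain f where
      f: "realizes f d [j1 # j2 # replicate ((r - 2) * k) 1, replicate k r, replicate k r]" ..
    have "j1 \<le> k" "j2 \<le> k"
      by (rule realizes_homogeneous_imp_le[OF f]; use assms in auto)+
    then show False using j by linarith
  qed
qed

end
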